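(* For every set of formulas $\Gamma\cup\{\varphi\}\subseteq \mathbf{F}(\Sigma_{\mathbf{bI}},\mathcal V)$: if $\Gamma\Vdash^{\mathbf{bI}}_{\mathcal F}\varphi$ then $\Gamma\vdash_{\mathbf{bI}}\varphi$.
   Context: Let $\mathcal V$ be a countable set of propositional variables and $\Sigma_{\mathbf{bI}}=\{\vee,\wedge,\rightarrow,\uparrow\}$, all connectives binary; $\mathbf F(\Sigma_{\mathbf{bI}},\mathcal V)$ is the set of formulas. The logic $\mathbf{bI}$ is the Hilbert calculus whose only inference rule is Modus Ponens and whose axioms are all instances (with arbitrary formulas) of: (1) $\alpha\to(\beta\to\alpha)$; (2) $(\alpha\to(\beta\to\gamma))\to((\alpha\to\beta)\to(\alpha\to\gamma))$; (3) $\alpha\to(\beta\to(\alpha\wedge\beta))$; (4) $(\alpha\wedge\beta)\to\alpha$; (5) $(\alpha\wedge\beta)\to\beta$; (6) $\alpha\to(\alpha\vee\beta)$; (7) $\beta\to(\alpha\vee\beta)$; (8) $(\alpha\to\gamma)\to((\beta\to\gamma)\to((\alpha\vee\beta)\to\gamma))$; (9) $(\alpha\to\beta)\vee\alpha$; (Ip) $(\alpha\uparrow\beta)\to(\alpha\to(\beta\to\gamma))$; (Comm) $(\alpha\uparrow\beta)\to(\beta\uparrow\alpha)$. $\Gamma\vdash_{\mathbf{bI}}\varphi$ means that there is a finite derivation of $\varphi$ from premises in $\Gamma$. A $\Sigma$-multialgebra on a nonempty set $A$ interprets each $n$-ary connective $\sigma$ as a function $\sigma_{\mathcal A}:A^n\to\wp(A)\setminus\{\emptyset\}$;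 an operation with only singleton values is identified with an ordinary operation. A valuation over $\mathcal A$ is a map $\nu$ from formulas to $A$ with $\nu(\sigma(\varphi_1,\dots,\varphi_n))\in\sigma_{\mathcal A}(\nu(\varphi_1),\dots,\nu(\varphi_n))$ for all connectives $\sigma$ and formulas $\varphi_i$. An RNmatrix (restricted non-deterministic matrix) for $\mathbf{bI}$ is a triple $(\mathcal A,D,\mathcal F)$ where: - $\mathcal A$ is a $\Sigma_{\mathbf{bI}}$-multialgebra with universe $A$ in which $\wedge,\vee,\to$ are ordinary operations making $A$ a Boolean algebra with bottom $0$ and top $1$ (with $\to$ the Boolean implication), and such that for all $a,b\in A$, $a\uparrow b=b\uparrow a$ (as sets), and for all $a,b,c\in A$, if $c\in a\uparrow b$ then $a\wedge b\wedge c=0$; - $D=\{1\}$ (designated elements; $D$ is a proper subset of $A$, i.e. $0\ne1$); - $\mathcal F$ is the set of all valuations $\nu$ over $\mathcal A$ with $\nu(\alpha\uparrow\beta)=\nu(\beta\uparrow\alpha)$ for all formulas $\alpha,\beta$. $\Gamma\Vdash^{\mathbf{bI}}_{\mathcal F}\varphi$ means: for every RNmatrix $(\mathcal A,D,\mathcal F)$ for $\mathbf{bI}$ and every $\nu\in\mathcal F$, if $\nu(\gamma)\in D$ for all $\gamma\in\Gamma$ then $\nu(\varphi)\in D$. *)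

theory Defs
  imports Main "HOL-Library.Countable"
begin

datatype connective = Disj | Conj | Impl | Incomp

datatype 'v fm = Var 'v | Con connective "'v fm" "'v fm"

abbreviation Or :: "'v fm \<Rightarrow> 'v fm \<Rightarrow> 'v fm" (infixr "\<^bold>\<or>" 130)
  where "\<alpha> \<^bold>\<or> \<beta> \<equiv> Con Disj \<alpha> \<beta>"

abbreviation And :: "'v fm \<Rightarrow> 'v fm \<Rightarrow> 'v fm" (infixr "\<^bold>\<and>" 135)
  where "\<alpha> \<^bold>\<and> \<beta> \<equiv> Con Conj \<alpha> \<beta>"

abbreviation Imp :: "'v fm \<Rightarrow> 'v fm \<Rightarrow> 'v fm" (infixr "\<^bold>\<rightarrow>" 125)
  where "\<alpha> \<^bold>\<rightarrow> \<beta> \<equiv> Con Impl \<alpha> \<beta>"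

abbreviation Inc :: "'v fm \<Rightarrow> 'v fm \<Rightarrow> 'v fm" (infix "\<^bold>\<up>" 140)
  where "\<alpha> \<^bold>\<up> \<beta> \<equiv> Con Incomp \<alpha> \<beta>"

inductive_set bI_axioms :: "'v fm set" where
  "\<alpha> \<^bold>\<rightarrow> (\<beta> \<^bold>\<rightarrow> \<alpha>) \<in> bI_axioms"
| "(\<alpha> \<^bold>\<rightarrow> (\<beta> \<^bold>\<rightarrow> \<gamma>)) \<^bold>\<rightarrow> ((\<alpha> \<^bold>\<rightarrow> \<beta>) \<^bold>\<rightarrow> (\<alpha> \<^bold>\<rightarrow> \<gamma>)) \<in> bI_axioms"
| "\<alpha> \<^bold>\<rightarrow> (\<beta> \<^bold>\<rightarrow> (\<alpha> \<^bold>\<and> \<beta>)) \<in> bI_axioms"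
| "(\<alpha> \<^bold>\<and> \<beta>) \<^bold>\<rightarrow> \<alpha> \<in> bI_axioms"
| "(\<alpha> \<^bold>\<and> \<beta>) \<^bold>\<rightarrow> \<beta> \<in> bI_axioms"
| "\<alpha> \<^bold>\<rightarrow> (\<alpha> \<^bold>\<or> \<beta>) \<in> bI_axioms"
| "\<beta> \<^bold>\<rightarrow> (\<alpha> \<^bold>\<or> \<beta>) \<in> bI_axioms"
| "(\<alpha> \<^bold>\<rightarrow> \<gamma>) \<^bold>\<rightarrow> ((\<beta> \<^bold>\<rightarrow> \<gamma>) \<^bold>\<rightarrow> ((\<alpha> \<^bold>\<or> \<beta>) \<^bold>\<rightarrow> \<gamma>)) \<in> bI_axioms"
| "(\<alpha> \<^bold>\<rightarrow> \<beta>) \<^bold>\<or> \<alpha> \<in> bI_axioms"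
| Ip: "(\<alpha> \<^bold>\<up> \<beta>) \<^bold>\<rightarrow> (\<alpha> \<^bold>\<rightarrow> (\<beta> \<^bold>\<rightarrow> \<gamma>)) \<in> bI_axioms"
| Comm: "(\<alpha> \<^bold>\<up> \<beta>) \<^bold>\<rightarrow> (\<beta> \<^bold>\<up> \<alpha>) \<in> bI_axioms"

inductive bI_derives :: "'v fm set \<Rightarrow> 'v fm \<Rightarrow> bool" (infix "\<turnstile>\<^sub>b\<^sub>I" 50) for \<Gamma> where
  premise: "\<phi> \<in> \<Gamma> \<Longrightarrow> \<Gamma> \<turnstile>\<^sub>b\<^sub>I \<phi>"
| axiom: "\<phi> \<in> bI_axioms \<Longrightarrow> \<Gamma> \<turnstile>\<^sub>b\<^sub>I \<phi>"
| modus_ponens: "\<Gamma> \<turnstile>\<^sub>b\<^sub>I \<phi> \<^bold>\<rightarrow> \<psi> \<Longrightarrow> \<Gamma> \<turnstile>\<^sub>b\<^sub>I \<phi> \<Longrightarrow> \<Gamma> \<turnstile>\<^sub>b\<^sub>I \<psi>"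

(* The axioms of abstract_boolean_algebra, relativised to a carrier set. *)
locale boolean_algebra_on =
  fixes A :: "'a set"
    and meet :: "'a \<Rightarrow> 'a \<Rightarrow> 'a"
    and join :: "'a \<Rightarrow> 'a \<Rightarrow> 'a"
    and compl :: "'a \<Rightarrow> 'a"
    and bottom :: 'a
    and top :: 'a
  assumes meet_closed: "a \<in> A \<Longrightarrow> b \<in> A \<Longrightarrow> meet a b \<in> A"
    and join_closed: "a \<in> A \<Longrightarrow> b \<in> A \<Longrightarrow> join a b \<in> A"
    and compl_closed: "a \<in> A \<Longrightarrow> compl a \<in> A"
    and bottom_closed: "bottom \<in> A"
    and top_closed: "top \<in> A"
    and meet_assoc: "a \<in> A \<Longrightarrow> b \<in> A \<Longrightarrow> c \<in> A \<Longrightarrow> meet (meet a b) c = meet a (meet b c)"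
    and meet_commute: "a \<in> A \<Longrightarrow> b \<in> A \<Longrightarrow> meet a b = meet b a"
    and join_assoc: "a \<in> A \<Longrightarrow> b \<in> A \<Longrightarrow> c \<in> A \<Longrightarrow> join (join a b) c = join a (join b c)"
    and join_commute: "a \<in> A \<Longrightarrow> b \<in> A \<Longrightarrow> join a b = join b a"
    and meet_join_distrib:
      "a \<in> A \<Longrightarrow> b \<in> A \<Longrightarrow> c \<in> A \<Longrightarrow> meet a (join b c) = join (meet a b) (meet a c)"
    and join_meet_distrib:
      "a \<in> A \<Longrightarrow> b \<in> A \<Longrightarrow> c \<in> A \<Longrightarrow> join a (meet b c) = meet (join a b) (join a c)"
    and meet_top: "a \<in> A \<Longrightarrow> meet a top = a"
    and join_bottom: "a \<in> A \<Longrightarrow> join a bottom = a"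
    and meet_compl: "a \<in> A \<Longrightarrow> meet a (compl a) = bottom"
    and join_compl: "a \<in> A \<Longrightarrow> join a (compl a) = top"

record 'a multialgebra =
  universe :: "'a set"
  mop :: "connective \<Rightarrow> 'a \<Rightarrow> 'a \<Rightarrow> 'a set"

definition is_multialgebra :: "'a multialgebra \<Rightarrow> bool" where
  "is_multialgebra M \<longleftrightarrow> universe M \<noteq> {} \<and>
     (\<forall>\<sigma>. \<forall>a\<in>universe M. \<forall>b\<in>universe M. mop M \<sigma> a b \<noteq> {} \<and> mop M \<sigma> a b \<subseteq> universe M)"

definition valuation :: "'a multialgebra \<Rightarrow> ('v fm \<Rightarrow> 'a) \<Rightarrow> bool" where
  "valuation M \<nu> \<longleftrightarrow> (\<forall>\<phi>. \<nu> \<phi> \<in> universe M) \<and>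
     (\<forall>\<sigma> \<phi> \<psi>. \<nu> (Con \<sigma> \<phi> \<psi>) \<in> mop M \<sigma> (\<nu> \<phi>) (\<nu> \<psi>))"

definition bI_RNmatrix :: "'a multialgebra \<Rightarrow> 'a set \<Rightarrow> ('v fm \<Rightarrow> 'a) set \<Rightarrow> bool" where
  "bI_RNmatrix M D F \<longleftrightarrow> is_multialgebra M \<and>
     (\<exists>meet join compl bottom top.
        boolean_algebra_on (universe M) meet join compl bottom top \<and> bottom \<noteq> top \<and>
        (\<forall>a\<in>universe M. \<forall>b\<in>universe M.
           mop M Conj a b = {meet a b} \<and>
           mop M Disj a b = {join a b} \<and>
           mop M Impl a b = {join (compl a) b} \<and>
           mop M Incomp a b = mop M Incomp b a \<and>
           (\<forall>c\<in>mop M Incomp a b. meet (meet a b) c = bottom)) \<and>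
        D = {top}) \<and>
     F = {\<nu>. valuation M \<nu> \<and> (\<forall>\<alpha> \<beta>. \<nu> (\<alpha> \<^bold>\<up> \<beta>) = \<nu> (\<beta> \<^bold>\<up> \<alpha>))}"

(* HOL cannot quantify over types inside a formula, so the type of which the universes are
   subsets is an explicit parameter of the consequence relation. *)
definition bI_entails :: "'a itself \<Rightarrow> 'v fm set \<Rightarrow> 'v fm \<Rightarrow> bool" where
  "bI_entails TYPE('a) \<Gamma> \<phi> \<longleftrightarrow>
     (\<forall>(M :: 'a multialgebra) D F. bI_RNmatrix M D F \<longrightarrow>
        (\<forall>\<nu>\<in>F. (\<forall>\<gamma>\<in>\<Gamma>. \<nu> \<gamma> \<in> D) \<longrightarrow> \<nu> \<phi> \<in> D))"

end

theory Submission
  imports Defs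
begin

text \<open>
  If \<open>\<Gamma>\<close> does not derive \<open>\<phi>\<close>, a single two-element structure already separates them. By Zorn's
  lemma \<open>\<Gamma>\<close> extends to a set \<open>\<Delta>\<close> that is maximal among the sets not deriving \<open>\<phi>\<close>
  (\<open>saturated_extension\<close>). The deduction theorem turns maximality into: \<open>\<alpha> \<notin> \<Delta>\<close> iff
  \<open>\<Delta>\<close> derives \<open>\<alpha> \<^bold>\<rightarrow> \<phi>\<close>. So \<open>\<phi>\<close> acts as a falsum, and membership in \<open>\<Delta>\<close> respects \<open>\<^bold>\<and>\<close>, \<open>\<^bold>\<or>\<close> and
  \<open>\<^bold>\<rightarrow>\<close> as classical truth does, the axiom \<open>(\<alpha> \<^bold>\<rightarrow> \<beta>) \<^bold>\<or> \<alpha>\<close> supplying the classical case of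
  implication.

  The value of \<open>\<alpha> \<^bold>\<up> \<beta>\<close> need not be determined by those of \<open>\<alpha>\<close> and \<open>\<beta>\<close>, and a multialgebra
  tolerates this: over the Boolean algebra with elements \<open>0\<close> and \<open>1\<close>, the largest admissible
  interpretation of \<open>\<^bold>\<up>\<close> yields \<open>{0}\<close> at \<open>(1, 1)\<close> and \<open>{0, 1}\<close> elsewhere. The axiom \<open>Ip\<close> is exactly
  what puts the characteristic function of \<open>\<Delta>\<close> within these bounds, since \<open>\<alpha>\<close>, \<open>\<beta>\<close> and \<open>\<alpha> \<^bold>\<up> \<beta>\<close>
  together would derive \<open>\<phi>\<close>; the axiom \<open>Comm\<close> makes it meet the restriction on valuations.
  Hence it is an admissible valuation satisfying \<open>\<Gamma>\<close> and refuting \<open>\<phi>\<close> (\<open>saturated_countermodel\<close>).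
  The two elements can be chosen in any type that has two distinct inhabitants.
\<close>

section \<open>Derivations\<close>

lemma derives_mono:
  assumes "\<Gamma> \<turnstile>\<^sub>b\<^sub>I \<psi>" and "\<Gamma> \<subseteq> \<Delta>"
  shows "\<Delta> \<turnstile>\<^sub>b\<^sub>I \<psi>"
  using assms by (induction rule: bI_derives.induct) (auto intro: bI_derives.intros)

lemma derives_weaken: "\<Gamma> \<turnstile>\<^sub>b\<^sub>I \<psi> \<Longrightarrow> \<Gamma> \<turnstile>\<^sub>b\<^sub>I \<alpha> \<^bold>\<rightarrow> \<psi>"
  by (rule modus_ponens[OF axiom[OF bI_axioms.intros(1)]])

lemma derives_imp_mp:
  assumes "\<Gamma> \<turnstile>\<^sub>b\<^sub>I \<alpha> \<^bold>\<rightarrow> (\<beta> \<^bold>\<rightarrow> \<gamma>)" and "\<Gamma> \<turnstile>\<^sub>b\<^sub>I \<alpha> \<^bold>\<rightarrow> \<beta>"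
  shows "\<Gamma> \<turnstile>\<^sub>b\<^sub>I \<alpha> \<^bold>\<rightarrow> \<gamma>"
  using modus_ponens[OF modus_ponens[OF axiom[OF bI_axioms.intros(2)] assms(1)] assms(2)] .

lemma derives_imp_refl: "\<Gamma> \<turnstile>\<^sub>b\<^sub>I \<alpha> \<^bold>\<rightarrow> \<alpha>"
  by (rule derives_imp_mp[where \<beta> = "\<alpha> \<^bold>\<rightarrow> \<alpha>"]; rule axiom; rule bI_axioms.intros(1))

lemma deduction_theorem:
  assumes "insert \<alpha> \<Gamma> \<turnstile>\<^sub>b\<^sub>I \<psi>"
  shows "\<Gamma> \<turnstile>\<^sub>b\<^sub>I \<alpha> \<^bold>\<rightarrow> \<psi>"
  using assms
proof (induction rule: bI_derives.induct)
  case (premise \<psi>)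
  then show ?case
    by (auto intro: derives_imp_refl derives_weaken bI_derives.premise)
next
  case (axiom \<psi>)
  then show ?case by (intro derives_weaken bI_derives.axiom)
next
  case (modus_ponens \<chi> \<psi>)
  then show ?case by (blast intro: derives_imp_mp)
qed

text \<open>A derivation uses finitely many premises, and in a chain two members that supply the
  premises of the two parts of a modus ponens are both contained in the larger one.\<close>

lemma derives_Union_chain:
  assumes "\<Union>C \<turnstile>\<^sub>b\<^sub>I \<psi>" and "subset.chain \<A> C" and "C \<noteq> {}"
  shows "\<exists>\<Delta>\<in>C. \<Delta> \<turnstile>\<^sub>b\<^sub>I \<psi>"
  using assms(1)
proof (induction rule: bI_derives.induct)
  case (premise \<psi>)
  then show ?case by (auto intro: bI_derives.premise)
next
  case (axiom \<psi>)
  then show ?case using assms(3) by (auto intro: bI_derives.axiom)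
next
  case (modus_ponens \<chi> \<psi>)
  then obtain \<Delta>\<^sub>1 \<Delta>\<^sub>2 where "\<Delta>\<^sub>1 \<in> C" "\<Delta>\<^sub>1 \<turnstile>\<^sub>b\<^sub>I \<chi> \<^bold>\<rightarrow> \<psi>" "\<Delta>\<^sub>2 \<in> C" "\<Delta>\<^sub>2 \<turnstile>\<^sub>b\<^sub>I \<chi>"
    by blast
  moreover have "\<Delta>\<^sub>1 \<subseteq> \<Delta>\<^sub>2 \<or> \<Delta>\<^sub>2 \<subseteq> \<Delta>\<^sub>1"
    using assms(2) \<open>\<Delta>\<^sub>1 \<in> C\<close> \<open>\<Delta>\<^sub>2 \<in> C\<close> by (auto simp: subset_chain_def)
  ultimately show ?case by (metis derives_mono bI_derives.modus_ponens)
qed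

section \<open>Saturated sets\<close>

definition saturated :: "'v fm \<Rightarrow> 'v fm set \<Rightarrow> bool" where
  "saturated \<phi> \<Delta> \<longleftrightarrow> \<not> \<Delta> \<turnstile>\<^sub>b\<^sub>I \<phi> \<and> (\<forall>\<alpha>. \<alpha> \<notin> \<Delta> \<longrightarrow> insert \<alpha> \<Delta> \<turnstile>\<^sub>b\<^sub>I \<phi>)"

lemma saturated_extension:
  assumes "\<not> \<Gamma> \<turnstile>\<^sub>b\<^sub>I \<phi>"
  obtains \<Delta> where "\<Gamma> \<subseteq> \<Delta>" and "saturated \<phi> \<Delta>"
proof -
  let ?\<A> = "{\<Delta>. \<Gamma> \<subseteq> \<Delta> \<and> \<not> \<Delta> \<turnstile>\<^sub>b\<^sub>I \<phi>}"
  have "\<exists>M\<in>?\<A>. \<forall>X\<in>?\<A>. M \<subseteq> X \<longrightarrow> X = M"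
  proof (rule subset_Zorn_nonempty)
    show "?\<A> \<noteq> {}" using assms by blast
  next
    fix C assume C: "C \<noteq> {}" "subset.chain ?\<A> C"
    then have "C \<subseteq> ?\<A>" by (simp add: subset_chain_def)
    moreover from this have "\<not> \<Union>C \<turnstile>\<^sub>b\<^sub>I \<phi>"
      using derives_Union_chain[OF _ C(2,1)] by blast
    ultimately show "\<Union>C \<in> ?\<A>" using C(1) by blast
  qed
  then obtain \<Delta> where \<Delta>: "\<Delta> \<in> ?\<A>" "\<forall>X\<in>?\<A>. \<Delta> \<subseteq> X \<longrightarrow> X = \<Delta>"
    by (rule bexE)
  show thesis
  proof
    show "\<Gamma> \<subseteq> \<Delta>" using \<Delta>(1) by simp
    have "insert \<alpha> \<Delta> \<turnstile>\<^sub>b\<^sub>I \<phi>" if "\<alpha> \<notin> \<Delta>" for \<alpha>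
      using \<Delta>(1) \<Delta>(2)[rule_format, of "insert \<alpha> \<Delta>"] that by blast
    with \<Delta>(1) show "saturated \<phi> \<Delta>" by (simp add: saturated_def)
  qed
qed

context
  fixes \<phi> :: "'v fm" and \<Delta> :: "'v fm set"
  assumes saturated: "saturated \<phi> \<Delta>"
begin

lemma saturated_refutes: "\<alpha> \<notin> \<Delta> \<Longrightarrow> \<Delta> \<turnstile>\<^sub>b\<^sub>I \<alpha> \<^bold>\<rightarrow> \<phi>"
  using saturated by (auto simp: saturated_def intro: deduction_theorem)

lemma saturated_mem_iff: "\<alpha> \<in> \<Delta> \<longleftrightarrow> \<Delta> \<turnstile>\<^sub>b\<^sub>I \<alpha>"
  using saturated saturated_refutes by (auto simp: saturated_def intro: premise modus_ponens)

lemma saturated_not_mem: "\<phi> \<notin> \<Delta>"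
  using saturated saturated_mem_iff by (simp add: saturated_def)

lemma saturated_axiom: "\<alpha> \<in> bI_axioms \<Longrightarrow> \<alpha> \<in> \<Delta>"
  by (simp add: saturated_mem_iff axiom)

lemma saturated_mp: "\<alpha> \<^bold>\<rightarrow> \<beta> \<in> \<Delta> \<Longrightarrow> \<alpha> \<in> \<Delta> \<Longrightarrow> \<beta> \<in> \<Delta>"
  unfolding saturated_mem_iff by (rule modus_ponens)

lemma saturated_And: "\<alpha> \<^bold>\<and> \<beta> \<in> \<Delta> \<longleftrightarrow> \<alpha> \<in> \<Delta> \<and> \<beta> \<in> \<Delta>"
  using saturated_mp[OF saturated_mp[OF saturated_axiom[OF bI_axioms.intros(3)]]]
    saturated_mp[OF saturated_axiom[OF bI_axioms.intros(4)]]
    saturated_mp[OF saturated_axiom[OF bI_axioms.intros(5)]]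
  by blast

text \<open>If neither disjunct belonged to \<open>\<Delta>\<close>, both would imply \<open>\<phi>\<close>, and then so would their
  disjunction.\<close>

lemma saturated_Or: "\<alpha> \<^bold>\<or> \<beta> \<in> \<Delta> \<longleftrightarrow> \<alpha> \<in> \<Delta> \<or> \<beta> \<in> \<Delta>"
proof
  assume or: "\<alpha> \<^bold>\<or> \<beta> \<in> \<Delta>"
  show "\<alpha> \<in> \<Delta> \<or> \<beta> \<in> \<Delta>"
  proof (rule ccontr)
    assume "\<not> (\<alpha> \<in> \<Delta> \<or> \<beta> \<in> \<Delta>)"
    then have "\<alpha> \<^bold>\<rightarrow> \<phi> \<in> \<Delta>" "\<beta> \<^bold>\<rightarrow> \<phi> \<in> \<Delta>"
      using saturated_refutes saturated_mem_iff by blast+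
    then have "\<phi> \<in> \<Delta>"
      using saturated_mp[OF saturated_mp[OF saturated_mp[OF saturated_axiom[OF bI_axioms.intros(8)]]]] or
      by blast
    then show False using saturated_not_mem by contradiction
  qed
qed (use saturated_mp[OF saturated_axiom[OF bI_axioms.intros(6)]]
    saturated_mp[OF saturated_axiom[OF bI_axioms.intros(7)]] in blast)

text \<open>When \<open>\<alpha> \<notin> \<Delta>\<close>, primeness applied to \<open>(\<alpha> \<^bold>\<rightarrow> \<beta>) \<^bold>\<or> \<alpha>\<close> leaves only the implication.\<close>

lemma saturated_Imp: "\<alpha> \<^bold>\<rightarrow> \<beta> \<in> \<Delta> \<longleftrightarrow> \<alpha> \<notin> \<Delta> \<or> \<beta> \<in> \<Delta>"
proof -
  have "(\<alpha> \<^bold>\<rightarrow> \<beta>) \<^bold>\<or> \<alpha> \<in> \<Delta>"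
    by (intro saturated_axiom bI_axioms.intros(9))
  moreover have "\<beta> \<^bold>\<rightarrow> (\<alpha> \<^bold>\<rightarrow> \<beta>) \<in> \<Delta>"
    by (intro saturated_axiom bI_axioms.intros(1))
  ultimately show ?thesis using saturated_Or saturated_mp by blast
qed

lemma saturated_Inc: "\<alpha> \<^bold>\<up> \<beta> \<in> \<Delta> \<Longrightarrow> \<not> (\<alpha> \<in> \<Delta> \<and> \<beta> \<in> \<Delta>)"
  using saturated_mp[OF saturated_mp[OF saturated_mp[OF saturated_axiom[OF Ip]]]] saturated_not_mem
  by blast

lemma saturated_Inc_commute: "\<alpha> \<^bold>\<up> \<beta> \<in> \<Delta> \<longleftrightarrow> \<beta> \<^bold>\<up> \<alpha> \<in> \<Delta>"
  using saturated_mp[OF saturated_axiom[OF Comm]] by blast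

end

section \<open>Two-element RNmatrices\<close>

text \<open>The value set of \<open>\<^bold>\<up>\<close> is as large as the condition \<open>a \<sqinter> b \<sqinter> c = 0\<close> allows, so that it
  accommodates every saturated set.\<close>

definition two_valued :: "'a \<Rightarrow> 'a \<Rightarrow> 'a multialgebra" where
  "two_valued f t = \<lparr>universe = {f, t},
     mop = (\<lambda>\<sigma> a b. case \<sigma> of
         Conj \<Rightarrow> {if a = t \<and> b = t then t else f}
       | Disj \<Rightarrow> {if a = t \<or> b = t then t else f}
       | Impl \<Rightarrow> {if a = t \<longrightarrow> b = t then t else f}
       | Incomp \<Rightarrow> (if a = t \<and> b = t then {f} else {f, t}))\<rparr>"

lemma two_element_boolean_algebra:
  assumes "f \<noteq> t"
  shows "boolean_algebra_on {f, t} (\<lambda>a b. if a = t \<and> b = t then t else f)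
    (\<lambda>a b. if a = t \<or> b = t then t else f) (\<lambda>a. if a = t then f else t) f t"
  using assms by unfold_locales auto

lemma two_valued_RNmatrix:
  assumes "f \<noteq> t"
  shows "bI_RNmatrix (two_valued f t) {t}
    {\<nu>. valuation (two_valued f t) \<nu> \<and> (\<forall>\<alpha> \<beta>. \<nu> (\<alpha> \<^bold>\<up> \<beta>) = \<nu> (\<beta> \<^bold>\<up> \<alpha>))}"
proof -
  have "is_multialgebra (two_valued f t)"
    by (auto simp: is_multialgebra_def two_valued_def split: connective.split)
  moreover have "boolean_algebra_on (universe (two_valued f t))
      (\<lambda>a b. if a = t \<and> b = t then t else f) (\<lambda>a b. if a = t \<or> b = t then t else f)
      (\<lambda>a. if a = t then f else t) f t"
    using two_element_boolean_algebra[OF assms] by (simp add: two_valued_def)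
  moreover have "\<forall>a\<in>universe (two_valued f t). \<forall>b\<in>universe (two_valued f t).
      mop (two_valued f t) Conj a b = {if a = t \<and> b = t then t else f} \<and>
      mop (two_valued f t) Disj a b = {if a = t \<or> b = t then t else f} \<and>
      mop (two_valued f t) Impl a b = {if (if a = t then f else t) = t \<or> b = t then t else f} \<and>
      mop (two_valued f t) Incomp a b = mop (two_valued f t) Incomp b a \<and>
      (\<forall>c\<in>mop (two_valued f t) Incomp a b.
        (if (if a = t \<and> b = t then t else f) = t \<and> c = t then t else f) = f)"
    using assms by (auto simp: two_valued_def)
  ultimately show ?thesis
    unfolding bI_RNmatrix_def using assms
    by (intro conjI exI[of _ f] exI[of _ t] exI[of _ "\<lambda>a. if a = t then f else t"]
        exI[of _ "\<lambda>a b. if a = t \<or> b = t then t else f"]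
        exI[of _ "\<lambda>a b. if a = t \<and> b = t then t else f"] refl)
qed

lemma saturated_valuation:
  assumes "saturated \<phi> \<Delta>"
  shows "valuation (two_valued f t) (\<lambda>\<alpha>. if \<alpha> \<in> \<Delta> then t else f)"
proof -
  let ?\<nu> = "\<lambda>\<alpha>. if \<alpha> \<in> \<Delta> then t else f"
  have "?\<nu> (Con \<sigma> \<alpha> \<beta>) \<in> mop (two_valued f t) \<sigma> (?\<nu> \<alpha>) (?\<nu> \<beta>)" for \<sigma> \<alpha> \<beta>
    by (cases \<sigma>) (auto simp: two_valued_def saturated_And[OF assms] saturated_Or[OF assms]
        saturated_Imp[OF assms] dest: saturated_Inc[OF assms])
  then show ?thesis by (simp add: valuation_def two_valued_def)
qed

lemma saturated_countermodel:
  fixes f t :: 'a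
  assumes "saturated \<phi> \<Delta>" and "f \<noteq> t" and "\<Gamma> \<subseteq> \<Delta>"
  shows "\<not> bI_entails TYPE('a) \<Gamma> \<phi>"
proof
  assume entails: "bI_entails TYPE('a) \<Gamma> \<phi>"
  define \<nu> where "\<nu> = (\<lambda>\<alpha>. if \<alpha> \<in> \<Delta> then t else f)"
  have "\<nu> \<in> {\<nu>. valuation (two_valued f t) \<nu> \<and> (\<forall>\<alpha> \<beta>. \<nu> (\<alpha> \<^bold>\<up> \<beta>) = \<nu> (\<beta> \<^bold>\<up> \<alpha>))}"
    using saturated_valuation[OF assms(1)] saturated_Inc_commute[OF assms(1)]
    by (simp add: \<nu>_def)
  moreover have "\<forall>\<gamma>\<in>\<Gamma>. \<nu> \<gamma> \<in> {t}" using assms(3) by (auto simp: \<nu>_def)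
  ultimately have "\<nu> \<phi> \<in> {t}"
    using entails two_valued_RNmatrix[OF assms(2)] unfolding bI_entails_def by blast
  then show False using saturated_not_mem[OF assms(1)] assms(2) by (simp add: \<nu>_def)
qed

section \<open>Completeness\<close>

theorem theorem3:
  fixes \<Gamma> :: "('v :: countable) fm set" and \<phi> :: "'v fm"
  assumes "infinite (UNIV :: 'a set)"
    and "bI_entails TYPE('a) \<Gamma> \<phi>"
  shows "\<Gamma> \<turnstile>\<^sub>b\<^sub>I \<phi>"
proof (rule ccontr)
  assume "\<not> \<Gamma> \<turnstile>\<^sub>b\<^sub>I \<phi>"
  then obtain \<Delta> where \<Delta>: "\<Gamma> \<subseteq> \<Delta>" "saturated \<phi> \<Delta>"
    by (rule saturated_extension)
  obtain f :: 'a where "f \<notin> {undefined}"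
    using ex_new_if_finite[OF assms(1), of "{undefined}"] by blast
  then have "f \<noteq> undefined" by simp
  from saturated_countermodel[OF \<Delta>(2) this \<Delta>(1)] assms(2) show False
    by contradiction
qed

end
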